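(* A vortex nerve with $k>2$ cycles contains $k-2$ ribbon nerves.
   Context: A filled cycle $\mathrm{cyc}\,A$ in a planar CW complex (cells are vertices, edges and filled triangles) is the part of the plane consisting of a simple closed curve (containing a finite, nonempty, path-connected collection of vertices) together with everything inside it; $\mathrm{cl}$, $\mathrm{int}$ denote closure and interior. Two filled cycles are nesting if one of them is contained entirely in the interior of the other. A vortex nerve is a nonempty collection of pairwise nesting (usually non-concentric) filled cycles, in a finite planar CW complex, whose common intersection is nonempty, with zero or more edges (filaments) attached between pairs of its cycles. Given nesting filled cycles $\mathrm{cyc}\,A,\mathrm{cyc}\,B$ with $\mathrm{cyc}\,B$ in the interior of $\mathrm{cyc}\,A$, the associated planar ribbon is $\mathrm{cl}(\mathrm{cyc}\,A)\setminus\mathrm{int}(\mathrm{cyc}\,B)$. The ribbons contained in a vortex nerve are those determined by pairs of cycles that are consecutive when the cycles are ordered by inclusion. A ribbon nerve is a nonempty collection of planar ribbons with nonempty common intersection; the ribbon nerves contained in a vortex nerve are the pairs $\{\mathrm{rb}\,E,\mathrm{rb}\,E'\}$ of distinct ribbons contained in the vortex nerve with $\mathrm{rb}\,E\cap\mathrm{rb}\,E'\neq\emptyset$ (overlapping ribbons sharing a common cycle). *)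

theory Defs
  imports "HOL-Analysis.Analysis"
begin

definition simple_closed_curve :: "complex set \<Rightarrow> bool" where
  "simple_closed_curve C \<longleftrightarrow>
     (\<exists>g. simple_path g \<and> pathfinish g = pathstart g \<and> path_image g = C)"

definition filled :: "complex set \<Rightarrow> complex set" where
  "filled C = C \<union> inside C"

(* The plane is the type complex.  Edges and triangles are stored as closed cells. *)
record planar_complex =
  vertices :: "complex set"
  edges :: "complex set set"
  triangles :: "complex set set"

(* Cells are topological: edges need not be straight, and an edge may be a loop at one
   vertex.  The open cells are the single vertices, the sets e - vertices K for edges e, and
   the interiors of the triangles; they are required to be pairwise disjoint, and the boundary
   of a cell is a union of cells of lower dimension.  For a finite complex the
   closure-finiteness and weak-topology axioms hold automatically. *)
definition finite_planar_CW :: "planar_complex \<Rightarrow> bool" where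
  "finite_planar_CW K \<longleftrightarrow>
     finite (vertices K) \<and> finite (edges K) \<and> finite (triangles K) \<and>
     (\<forall>e\<in>edges K. \<exists>g. simple_path g \<and> path_image g = e \<and>
        e \<inter> vertices K = {pathstart g, pathfinish g}) \<and>
     (\<forall>e\<in>edges K. \<forall>e'\<in>edges K. e \<noteq> e' \<longrightarrow> e \<inter> e' \<subseteq> vertices K) \<and>
     (\<forall>t\<in>triangles K. \<exists>S\<subseteq>edges K. card S = 3 \<and>
        simple_closed_curve (\<Union>S) \<and> t = filled (\<Union>S)) \<and>
     (\<forall>t\<in>triangles K. interior t \<inter> (vertices K \<union> \<Union>(edges K)) = {}) \<and>
     (\<forall>t\<in>triangles K. \<forall>t'\<in>triangles K. t \<noteq> t' \<longrightarrow> interior t \<inter> interior t' = {})"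

(* A cycle is a simple closed curve running along edges of K.  That its vertices form a finite,
   nonempty, path-connected collection is a consequence: see cycle_vertices below. *)
definition cycle_of :: "planar_complex \<Rightarrow> complex set \<Rightarrow> bool" where
  "cycle_of K C \<longleftrightarrow> simple_closed_curve C \<and> (\<exists>S\<subseteq>edges K. C = \<Union>S)"

definition filled_cycle :: "planar_complex \<Rightarrow> complex set \<Rightarrow> bool" where
  "filled_cycle K A \<longleftrightarrow> (\<exists>C. cycle_of K C \<and> A = filled C)"

lemma cycle_vertices:
  assumes K: "finite_planar_CW K" and C: "cycle_of K C"
  shows "finite (C \<inter> vertices K)" "C \<inter> vertices K \<noteq> {}"
    and "\<forall>v\<in>C \<inter> vertices K. \<forall>w\<in>C \<inter> vertices K. path_component C v w"
proof -
  show "finite (C \<inter> vertices K)"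
    using K by (simp add: finite_planar_CW_def)
  obtain g where g: "simple_path g" "path_image g = C"
    using C by (auto simp: cycle_of_def simple_closed_curve_def)
  obtain S where S: "S \<subseteq> edges K" "C = \<Union>S"
    using C by (auto simp: cycle_of_def)
  have "C \<noteq> {}"
    using g(2) path_image_nonempty[of g] by simp
  then obtain e where e: "e \<in> S"
    using S(2) by auto
  have "e \<in> edges K"
    using e S(1) by (rule subsetD[rotated])
  moreover have "\<forall>e\<in>edges K. \<exists>g. simple_path g \<and> path_image g = e \<and>
      e \<inter> vertices K = {pathstart g, pathfinish g}"
    using K unfolding finite_planar_CW_def by (elim conjE)
  ultimately obtain h where "e \<inter> vertices K = {pathstart h, pathfinish h}"
    by meson
  then have "pathstart h \<in> e \<inter> vertices K"
    by simp
  then show "C \<inter> vertices K \<noteq> {}"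
    using e S(2) by auto
  have "path_connected C"
    using path_connected_path_image[OF simple_path_imp_path[OF g(1)]] g(2) by simp
  then show "\<forall>v\<in>C \<inter> vertices K. \<forall>w\<in>C \<inter> vertices K. path_component C v w"
    by (auto simp: path_connected_component)
qed

definition nesting :: "complex set \<Rightarrow> complex set \<Rightarrow> bool" where
  "nesting A B \<longleftrightarrow> A \<subseteq> interior B \<or> B \<subseteq> interior A"

(* The frontier of a filled cycle is its bounding curve: a filament has one end
   on each of the two curves. *)
definition filament_between ::
    "planar_complex \<Rightarrow> complex set \<Rightarrow> complex set \<Rightarrow> complex set \<Rightarrow> bool" where
  "filament_between K e A B \<longleftrightarrow> e \<in> edges K \<and>
     (\<exists>v w. e \<inter> vertices K = {v, w} \<and> v \<in> frontier A \<and> w \<in> frontier B)"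

definition vortex_nerve ::
    "planar_complex \<Rightarrow> complex set set \<Rightarrow> complex set set \<Rightarrow> bool" where
  "vortex_nerve K \<C> \<F> \<longleftrightarrow> finite_planar_CW K \<and>
     \<C> \<noteq> {} \<and> (\<forall>A\<in>\<C>. filled_cycle K A) \<and> pairwise nesting \<C> \<and> \<Inter>\<C> \<noteq> {} \<and>
     (\<forall>e\<in>\<F>. \<exists>A\<in>\<C>. \<exists>B\<in>\<C>. A \<noteq> B \<and> filament_between K e A B)"

definition ribbon :: "complex set \<Rightarrow> complex set \<Rightarrow> complex set" where
  "ribbon A B = closure A - interior B"

definition planar_ribbon :: "planar_complex \<Rightarrow> complex set \<Rightarrow> bool" where
  "planar_ribbon K R \<longleftrightarrow>
     (\<exists>A B. filled_cycle K A \<and> filled_cycle K B \<and> B \<subseteq> interior A \<and> R = ribbon A B)"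

definition ribbon_nerve :: "planar_complex \<Rightarrow> complex set set \<Rightarrow> bool" where
  "ribbon_nerve K N \<longleftrightarrow> N \<noteq> {} \<and> (\<forall>R\<in>N. planar_ribbon K R) \<and> \<Inter>N \<noteq> {}"

definition consecutive :: "complex set set \<Rightarrow> complex set \<Rightarrow> complex set \<Rightarrow> bool" where
  "consecutive \<C> A B \<longleftrightarrow>
     A \<in> \<C> \<and> B \<in> \<C> \<and> B \<subset> A \<and> \<not> (\<exists>D\<in>\<C>. B \<subset> D \<and> D \<subset> A)"

definition ribbons_in :: "complex set set \<Rightarrow> complex set set" where
  "ribbons_in \<C> = {ribbon A B | A B. consecutive \<C> A B}"

definition ribbon_nerves_in :: "planar_complex \<Rightarrow> complex set set \<Rightarrow> complex set set set" where
  "ribbon_nerves_in K \<C> =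
     {{E, E'} | E E'. E \<in> ribbons_in \<C> \<and> E' \<in> ribbons_in \<C> \<and> E \<noteq> E' \<and> ribbon_nerve K {E, E'}}"

end

theory Submission
  imports Defs
begin

text \<open>
  Inclusion orders the cycles as \<open>A\<^sub>0 \<subset> \<dots> \<subset> A\<^sub>k\<^sub>-\<^sub>1\<close>, each contained in the interior of the
  next, so the ribbons are \<open>R\<^sub>i = A\<^sub>i\<^sub>+\<^sub>1 - int A\<^sub>i\<close> for \<open>i < k - 1\<close>.  Neighbouring ribbons share the
  curve \<open>frontier A\<^sub>i\<^sub>+\<^sub>1\<close>, whereas for \<open>j > i + 1\<close> the ribbon \<open>R\<^sub>i\<close> lies in the interior of \<open>A\<^sub>j\<close>,
  which \<open>R\<^sub>j\<close> avoids.  Hence the ribbon nerves are exactly the \<open>k - 2\<close> pairs of neighbours.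
\<close>

text \<open>Counting the strict predecessors of an element is strictly monotone, hence injective on
  a chain, and its values lie below \<open>card C\<close>. By cardinality it is onto
  \<open>{..<card C}\<close>, and its inverse is the enumeration.\<close>

lemma finite_chain_enumeration:
  fixes C :: "'a::order set"
  assumes fin: "finite C" and chain: "\<And>x y. x \<in> C \<Longrightarrow> y \<in> C \<Longrightarrow> x \<le> y \<or> y \<le> x"
  obtains A where "bij_betw A {..<card C} C" "strict_mono_on {..<card C} A"
proof -
  define rank where "rank x = card {y \<in> C. y < x}" for x
  have rank_less: "rank x < rank y" if "x \<in> C" "x < y" for x y
    unfolding rank_def
    by (rule psubset_card_mono) (use fin that in auto)
  have inj: "inj_on rank C"
  proof (rule inj_onI)
    fix x y assume *: "x \<in> C" "y \<in> C" "rank x = rank y"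
    then show "x = y"
      using chain[of x y] rank_less[of x y] rank_less[of y x] by (auto simp: le_less)
  qed
  have "rank x < card C" if "x \<in> C" for x
    unfolding rank_def
    by (rule psubset_card_mono) (use fin that in auto)
  then have img: "rank ` C = {..<card C}"
    by (intro card_subset_eq) (auto simp: card_image[OF inj])
  define A where "A = inv_into C rank"
  have bij: "bij_betw A {..<card C} C"
    unfolding A_def by (rule bij_betw_inv_into) (simp add: bij_betw_def inj img)
  have rank_A: "rank (A i) = i" if "i < card C" for i
    unfolding A_def using that img by (simp add: f_inv_into_f)
  have "strict_mono_on {..<card C} A"
  proof (rule strict_mono_onI)
    fix i j assume ij: "i \<in> {..<card C}" "j \<in> {..<card C}" "i < j"
    then have "A i \<in> C" "A j \<in> C"
      using bij by (auto dest: bij_betwE)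
    then show "A i < A j"
      using chain[of "A i" "A j"] rank_less[of "A j" "A i"] rank_A[of i] rank_A[of j] ij
      by (auto simp: le_less)
  qed
  with bij show thesis
    by (rule that)
qed

lemma filled_cycle_compact:
  assumes "filled_cycle K A"
  shows "compact A"
proof -
  obtain g where g: "simple_path g" "A = path_image g \<union> inside (path_image g)"
    using assms
    by (auto simp: filled_cycle_def cycle_of_def simple_closed_curve_def filled_def)
  then have "compact (path_image g)"
    by (simp add: compact_simple_path_image)
  then show ?thesis
    using g by (simp add: compact_eq_bounded_closed bounded_inside closed_path_image_Un_inside
        simple_path_imp_path)
qed

lemma filled_cycle_nonempty:
  assumes "filled_cycle K A"
  shows "A \<noteq> {}"
  using assms path_image_nonempty
  by (fastforce simp: filled_cycle_def cycle_of_def simple_closed_curve_def filled_def)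

text \<open>The plane is connected, so only the empty set and the whole plane have empty frontier; a
  filled cycle is nonempty and bounded.\<close>

lemma filled_cycle_frontier_nonempty:
  assumes "filled_cycle K A"
  shows "frontier A \<noteq> {}"
  using frontier_not_empty[OF filled_cycle_nonempty[OF assms]] filled_cycle_compact[OF assms]
    not_bounded_UNIV compact_imp_bounded by blast

lemma filled_cycle_closure: "filled_cycle K A \<Longrightarrow> closure A = A"
  by (simp add: closure_closed compact_imp_closed filled_cycle_compact)

text \<open>Strictness comes from the frontier of \<open>A\<close>: it is nonempty, lies in the
  closed set \<open>A\<close> and misses \<open>interior A\<close>.\<close>

lemma filled_cycle_psubset:
  assumes "filled_cycle K A" "B \<subseteq> interior A"
  shows "B \<subset> A"
  using assms filled_cycle_frontier_nonempty[OF assms(1)] interior_subset[of A]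
    filled_cycle_closure[OF assms(1)]
  by (auto simp: frontier_def)

lemma vortex_nerve_enumeration:
  assumes "vortex_nerve K \<C> \<F>" and fin: "finite \<C>"
  obtains A where "bij_betw A {..<card \<C>} \<C>" "strict_mono_on {..<card \<C>} A"
    "\<And>i j. i < j \<Longrightarrow> j < card \<C> \<Longrightarrow> A i \<subseteq> interior (A j)"
proof -
  have cyc: "filled_cycle K X" if "X \<in> \<C>" for X
    using assms(1) that by (auto simp: vortex_nerve_def)
  have nest: "X \<subseteq> interior Y \<or> Y \<subseteq> interior X" if "X \<in> \<C>" "Y \<in> \<C>" "X \<noteq> Y" for X Y
    using assms(1) that by (auto simp: vortex_nerve_def pairwise_def nesting_def)
  obtain A where A: "bij_betw A {..<card \<C>} \<C>" "strict_mono_on {..<card \<C>} A"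
  proof (rule finite_chain_enumeration[OF fin])
    show "X \<subseteq> Y \<or> Y \<subseteq> X" if "X \<in> \<C>" "Y \<in> \<C>" for X Y
      using nest[OF that] interior_subset by blast
  qed
  have "A i \<subseteq> interior (A j)" if "i < j" "j < card \<C>" for i j
  proof -
    have "A i \<in> \<C>" "A j \<in> \<C>"
      using A(1) that by (auto dest: bij_betwE)
    moreover have "A i \<subset> A j"
      using A(2) that by (auto simp: strict_mono_on_def)
    \<comment> \<open>Nesting leaves open which cycle is the inner one; \<open>A j\<close> inside
      \<open>interior (A i)\<close> would make \<open>A j\<close> a proper subset of
      \<open>A i\<close>.\<close>
    ultimately show ?thesis
      using nest[of "A i" "A j"] filled_cycle_psubset[OF cyc, of "A i" "A j"] by blast
  qed
  with A show thesis
    by (rule that)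
qed

lemma consecutive_enumeration:
  assumes bij: "bij_betw A {..<n} \<C>" and mono: "strict_mono_on {..<n} A"
  shows "consecutive \<C> X Y \<longleftrightarrow> (\<exists>i. Suc i < n \<and> X = A (Suc i) \<and> Y = A i)"
proof -
  have img: "\<C> = A ` {..<n}"
    using bij by (simp add: bij_betw_def)
  have less: "A i \<subset> A j \<longleftrightarrow> i < j" if "i < n" "j < n" for i j
    using strict_mono_on_less[OF mono] that by simp
  show ?thesis
  proof
    assume c: "consecutive \<C> X Y"
    then obtain i j where ij: "i < n" "j < n" "X = A j" "Y = A i"
      by (auto simp: consecutive_def img)
    then have "i < j"
      using c less by (auto simp: consecutive_def)
    \<comment> \<open>Otherwise \<open>A (Suc i)\<close> would be a cycle strictly between
      \<open>Y\<close> and \<open>X\<close>.\<close>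
    moreover have "\<not> (A i \<subset> A (Suc i) \<and> A (Suc i) \<subset> A j)"
      using c ij \<open>i < j\<close> by (auto simp: consecutive_def img)
    ultimately have "j = Suc i"
      using less[of i "Suc i"] less[of "Suc i" j] ij by linarith
    with ij show "\<exists>i. Suc i < n \<and> X = A (Suc i) \<and> Y = A i"
      by auto
  next
    assume "\<exists>i. Suc i < n \<and> X = A (Suc i) \<and> Y = A i"
    then obtain i where "Suc i < n" "X = A (Suc i)" "Y = A i"
      by blast
    then show "consecutive \<C> X Y"
      unfolding consecutive_def img by (auto simp: less)
  qed
qed

theorem theorem4:
  fixes K :: planar_complex and \<C> \<F> :: "complex set set" and k :: nat
  assumes "vortex_nerve K \<C> \<F>"
    and "card \<C> = k"
    and "k > 2"
  shows "card (ribbon_nerves_in K \<C>) = k - 2"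
proof -
  \<comment> \<open>An infinite set has \<open>card\<close> 0, so \<open>k > 2\<close> forces
    finiteness.\<close>
  have "finite \<C>"
    using assms(2,3) by (intro card_ge_0_finite) simp
  then obtain A where bij: "bij_betw A {..<k} \<C>" and mono: "strict_mono_on {..<k} A"
    and nested: "\<And>i j. i < j \<Longrightarrow> j < k \<Longrightarrow> A i \<subseteq> interior (A j)"
    using vortex_nerve_enumeration[OF assms(1)] assms(2) by metis
  have cyc: "filled_cycle K (A i)" if "i < k" for i
    using assms(1) bij_betwE[OF bij] that by (auto simp: vortex_nerve_def)
  define R where "R i = ribbon (A (Suc i)) (A i)" for i
  have R_eq: "R i = A (Suc i) - interior (A i)" if "Suc i < k" for i
    using that by (simp add: R_def ribbon_def filled_cycle_closure[OF cyc])
  have frontier_sub: "frontier (A i) \<subseteq> A i" if "i < k" for i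
    using that by (simp add: compact_imp_closed filled_cycle_compact[OF cyc] frontier_subset_closed)
  have frontier_R: "frontier (A i) \<subseteq> R i" if "Suc i < k" for i
    using R_eq[OF that] frontier_sub[of i] nested[of i "Suc i"] interior_subset[of "A (Suc i)"] that
    by (auto simp: frontier_def)
  \<comment> \<open>The outer curve survives because the removed part lies in the interior of
    \<open>A (Suc i)\<close>.\<close>
  have frontier_R': "frontier (A (Suc i)) \<subseteq> R i" if "Suc i < k" for i
    using R_eq[OF that] frontier_sub[of "Suc i"] nested[of i "Suc i"] interior_subset[of "A i"] that
    by (auto simp: frontier_def)
  have R_avoids: "R j \<inter> A i = {}" if "i < j" "Suc j < k" for i j
    using R_eq[of j] nested[of i j] that by auto
  \<comment> \<open>The inner curve of \<open>R i\<close> tells the two apart: it is a nonempty part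
    of \<open>A i\<close>, which \<open>R j\<close> avoids.\<close>
  have R_neq: "R i \<noteq> R j" if "i < j" "Suc j < k" for i j
    using filled_cycle_frontier_nonempty[OF cyc, of i] frontier_R[of i] frontier_sub[of i]
      R_avoids[of i j] that by fastforce
  have R_inj: "R i = R j \<longleftrightarrow> i = j" if "Suc i < k" "Suc j < k" for i j
    using R_neq[of i j] R_neq[of j i] that by (metis linorder_neqE_nat)
  have meet: "R i \<inter> R j \<noteq> {} \<longleftrightarrow> j = Suc i" if "i < j" "Suc j < k" for i j
  proof
    assume "R i \<inter> R j \<noteq> {}"
    moreover have "R i \<subseteq> A (Suc i)"
      using R_eq[of i] that by auto
    ultimately have "\<not> Suc i < j"
      using R_avoids[of "Suc i" j] that by blast
    then show "j = Suc i"
      using that by simp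
  next
    assume "j = Suc i"
    \<comment> \<open>The shared curve \<open>frontier (A j)\<close> is the outer one of
      \<open>R i\<close> and the inner one of \<open>R j\<close>.\<close>
    then show "R i \<inter> R j \<noteq> {}"
      using filled_cycle_frontier_nonempty[OF cyc, of j] frontier_R[of j] frontier_R'[of i] that
      by auto
  qed
  have ribbons: "ribbons_in \<C> = R ` {i. Suc i < k}"
    unfolding ribbons_in_def consecutive_enumeration[OF bij mono] R_def by blast
  have planar: "planar_ribbon K (R i)" if "Suc i < k" for i
    unfolding planar_ribbon_def R_def
    using that cyc[of i] cyc[of "Suc i"] nested[of i "Suc i"] by auto
  \<comment> \<open>The second ribbon of a pair needs \<open>Suc (Suc i) < k\<close>, hence the
    bound \<open>k - 2\<close> on the index of the first.\<close>
  have "ribbon_nerves_in K \<C> = (\<lambda>i. {R i, R (Suc i)}) ` {..<k - 2}"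
  proof (intro equalityI subsetI)
    fix N assume "N \<in> ribbon_nerves_in K \<C>"
    then obtain i j where N: "N = {R i, R j}" "R i \<noteq> R j" "R i \<inter> R j \<noteq> {}"
      and ij: "Suc i < k" "Suc j < k"
      unfolding ribbon_nerves_in_def ribbon_nerve_def ribbons by auto
    have "j = Suc i \<or> i = Suc j"
      using N meet[of i j] meet[of j i] ij by (metis Int_commute linorder_neqE_nat)
    then show "N \<in> (\<lambda>i. {R i, R (Suc i)}) ` {..<k - 2}"
      using N ij by (auto simp: insert_commute)
  next
    fix N assume "N \<in> (\<lambda>i. {R i, R (Suc i)}) ` {..<k - 2}"
    then obtain i where i: "Suc (Suc i) < k" "N = {R i, R (Suc i)}"
      by (force simp: less_diff_conv)
    then have "ribbon_nerve K {R i, R (Suc i)}"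
      using meet[of i "Suc i"] planar[of i] planar[of "Suc i"] by (auto simp: ribbon_nerve_def)
    moreover have "R i \<in> ribbons_in \<C>" "R (Suc i) \<in> ribbons_in \<C>" "R i \<noteq> R (Suc i)"
      using i R_inj[of i "Suc i"] by (auto simp: ribbons)
    ultimately show "N \<in> ribbon_nerves_in K \<C>"
      unfolding ribbon_nerves_in_def i(2) by blast
  qed
  moreover have "inj_on (\<lambda>i. {R i, R (Suc i)}) {..<k - 2}"
  proof (rule inj_onI)
    fix i j assume "i \<in> {..<k - 2}" "j \<in> {..<k - 2}" "{R i, R (Suc i)} = {R j, R (Suc j)}"
    then show "i = j"
      \<comment> \<open>Unordered pairs could also agree crosswise, but \<open>i = Suc j\<close> and
        \<open>Suc i = j\<close> contradict each other.\<close>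
      by (auto simp: doubleton_eq_iff R_inj)
  qed
  ultimately show ?thesis
    by (simp add: card_image)
qed

end
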